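(* For all constants $a,c>0$ there is a constant $C>0$ such that for every integer $n\ge 2$ and every $f:\{0,1\}^n\to\{0,1\}$ computed by a DNF formula of width at most $a\log n$, there is a DNF formula $g$ on the same $n$ variables of width at most $C\log n$ and with at most $n^{C\log\log n}$ terms such that $\Pr_{x}[f(x)\ne g(x)]\le n^{-c}$, where $x$ is uniform in $\{0,1\}^n$.
   Context: A DNF formula is an OR of terms, each term being an AND of literals; its width is the maximum number of literals in a term. The empty term is the constant $1$ and the empty OR is the constant $0$. Convention: $\log(y)$ is read as $\max\{2,\log_2 y\}$ (so $\log\log n\ge 2$). *)

theory Defs
  imports "HOL-Probability.Probability"
begin

text \<open>The convention \<open>log y = max {2, log\<^sub>2 y}\<close>; only ever applied to \<open>y > 0\<close>.\<close>

definition lg :: "real \<Rightarrow> real" where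
  "lg y = max 2 (log 2 y)"

text \<open>The Boolean cube \<open>{0,1}\<^sup>n\<close>, with coordinates \<open>0, \<dots>, n - 1\<close>. Points are extensional
  (\<open>undefined\<close> off \<open>{..<n}\<close>), so the set is finite with \<open>2^n\<close> elements.\<close>

definition cube :: "nat \<Rightarrow> (nat \<Rightarrow> bool) set" where
  "cube n = {..<n} \<rightarrow>\<^sub>E (UNIV :: bool set)"

datatype literal = Pos (var: nat) | Neg (var: nat)

fun eval_literal :: "literal \<Rightarrow> (nat \<Rightarrow> bool) \<Rightarrow> bool" where
  "eval_literal (Pos i) x = x i"
| "eval_literal (Neg i) x = (\<not> x i)"

text \<open>A conjunction of literals is the set of its literals and a DNF formula is the set of its
  terms, so repeated literals and repeated terms are counted once. Contradictory terms
  are allowed.\<close>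

type_synonym dnf_term = "literal set"
type_synonym dnf = "dnf_term set"

definition eval_term :: "dnf_term \<Rightarrow> (nat \<Rightarrow> bool) \<Rightarrow> bool" where
  "eval_term T x \<longleftrightarrow> (\<forall>l\<in>T. eval_literal l x)"

definition eval_dnf :: "dnf \<Rightarrow> (nat \<Rightarrow> bool) \<Rightarrow> bool" where
  "eval_dnf F x \<longleftrightarrow> (\<exists>T\<in>F. eval_term T x)"

text \<open>Only \<open>2 n\<close> literals are available on \<open>n\<close> variables, so such a formula and all
  its terms are finite sets and the cardinalities below are the true ones.\<close>

definition dnf_on :: "nat \<Rightarrow> dnf \<Rightarrow> bool" where
  "dnf_on n F \<longleftrightarrow> (\<forall>T\<in>F. \<forall>l\<in>T. var l < n)"

text \<open>The empty DNF formula gets width \<open>0\<close>.\<close>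

definition dnf_width :: "dnf \<Rightarrow> nat" where
  "dnf_width F = Max (insert 0 (card ` F))"

definition computes :: "nat \<Rightarrow> dnf \<Rightarrow> ((nat \<Rightarrow> bool) \<Rightarrow> bool) \<Rightarrow> bool" where
  "computes n F f \<longleftrightarrow> dnf_on n F \<and> (\<forall>x\<in>cube n. eval_dnf F x = f x)"

end

theory Submission
  imports Defs
begin

text \<open>Let \<open>K\<close> be about \<open>w m\<close>. A family of sets of size at most \<open>w\<close> with more than \<open>K^w\<close> members has
  a maximal \<open>T\<close> that is contained in at least a fraction \<open>K^(-card T)\<close> of them. By maximality, the sets
  \<open>h - T\<close>, for the members \<open>h\<close> containing \<open>T\<close>, are so spread out that a uniformly random set
  contains one of them except with probability \<open>2^(-m)\<close>. In a DNF formula, all terms that contain \<open>T\<close>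
  can thus be replaced by the single term \<open>T\<close>. Repeating this leaves at most \<open>(2 K)^w\<close> terms. There
  are at most \<open>n^(2 w + 2)\<close> replacements, so \<open>m\<close> of order \<open>w log n\<close> makes the total error at most
  \<open>n^(-c)\<close>, and \<open>K\<close> is polylogarithmic in \<open>n\<close> for \<open>w\<close> of order \<open>log n\<close>.\<close>

section \<open>Biased random subsets of a finite set, and down-closed families\<close>

text \<open>The expectation of \<open>f S\<close> for a random \<open>S\<close> that receives each
  element of \<open>V\<close> independently with probability \<open>p\<close>.\<close>

definition biased_mean :: "real \<Rightarrow> 'a set \<Rightarrow> ('a set \<Rightarrow> real) \<Rightarrow> real" where
  "biased_mean p V f = (\<Sum>S\<in>Pow V. p ^ card S * (1 - p) ^ card (V - S) * f S)"

lemma biased_mean_empty [simp]: "biased_mean p {} f = f {}"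
  by (simp add: biased_mean_def)

text \<open>Conditions on whether \<open>v\<close> lies in the random set; this recursion drives the
  inductions on \<open>V\<close> below.\<close>

lemma biased_mean_insert:
  assumes "finite V" "v \<notin> V"
  shows "biased_mean p (insert v V) f =
    (1 - p) * biased_mean p V f + p * biased_mean p V (\<lambda>S. f (insert v S))"
proof -
  let ?g = "\<lambda>S. p ^ card S * (1 - p) ^ card (insert v V - S) * f S"
  have "biased_mean p (insert v V) f = sum ?g (Pow V) + sum ?g (insert v ` Pow V)"
    unfolding biased_mean_def Pow_insert using assms by (subst sum.union_disjoint) auto
  moreover have "sum ?g (Pow V) = (1 - p) * biased_mean p V f"
    unfolding biased_mean_def sum_distrib_left
  proof (rule sum.cong)
    fix S assume "S \<in> Pow V"
    then have "insert v V - S = insert v (V - S)" "v \<notin> V - S" using assms by auto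
    then have "card (insert v V - S) = Suc (card (V - S))" using assms by simp
    then show "?g S = (1 - p) * (p ^ card S * (1 - p) ^ card (V - S) * f S)" by simp
  qed simp
  moreover have "sum ?g (insert v ` Pow V) = p * biased_mean p V (\<lambda>S. f (insert v S))"
  proof -
    have "inj_on (insert v) (Pow V)"
      using assms by (auto simp: inj_on_def)
    then have "sum ?g (insert v ` Pow V) = (\<Sum>S\<in>Pow V. ?g (insert v S))"
      by (simp add: sum.reindex)
    also have "\<dots> = p * biased_mean p V (\<lambda>S. f (insert v S))"
      unfolding biased_mean_def sum_distrib_left
    proof (rule sum.cong)
      fix S assume S: "S \<in> Pow V"
      then have "insert v V - insert v S = V - S" "v \<notin> S" "finite S"
        using assms finite_subset by auto
      then show "?g (insert v S) =
          p * (p ^ card S * (1 - p) ^ card (V - S) * f (insert v S))" by simp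
    qed simp
    finally show ?thesis .
  qed
  ultimately show ?thesis by simp
qed

lemma biased_mean_mono:
  assumes "0 \<le> p" "p \<le> 1" "\<And>S. S \<subseteq> V \<Longrightarrow> f S \<le> g S"
  shows "biased_mean p V f \<le> biased_mean p V g"
  unfolding biased_mean_def using assms by (intro sum_mono mult_left_mono) auto

lemma biased_mean_cong:
  "(\<And>S. S \<subseteq> V \<Longrightarrow> f S = g S) \<Longrightarrow> biased_mean p V f = biased_mean p V g"
  unfolding biased_mean_def by (intro sum.cong) auto

lemma biased_mean_add:
  "biased_mean p V (\<lambda>S. f S + g S) = biased_mean p V f + biased_mean p V g"
  unfolding biased_mean_def by (simp add: algebra_simps sum.distrib)

lemma biased_mean_cmult: "biased_mean p V (\<lambda>S. c * f S) = c * biased_mean p V f"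
  unfolding biased_mean_def by (simp add: algebra_simps sum_distrib_left)

lemma biased_mean_sum:
  "biased_mean p V (\<lambda>S. \<Sum>i\<in>I. f i S) = (\<Sum>i\<in>I. biased_mean p V (f i))"
  unfolding biased_mean_def sum_distrib_left by (rule sum.swap)

lemma biased_mean_const:
  assumes "finite V"
  shows "biased_mean p V (\<lambda>S. c) = c"
  using assms by (induction V) (auto simp: biased_mean_insert algebra_simps)

text \<open>By independence: in the induction, each \<open>v\<close> in \<open>T\<close> kills the
  branch that omits \<open>v\<close> and contributes a factor \<open>p\<close>.\<close>

lemma biased_mean_superset:
  assumes "finite V" "T \<subseteq> V"
  shows "biased_mean p V (\<lambda>S. of_bool (T \<subseteq> S)) = p ^ card T"
  using assms
proof (induction V arbitrary: T)
  case empty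
  then show ?case by simp
next
  case (insert v V)
  show ?case
  proof (cases "v \<in> T")
    case True
    have "biased_mean p V (\<lambda>S. of_bool (T \<subseteq> S)) = biased_mean p V (\<lambda>S. 0)"
      using True insert.hyps by (intro biased_mean_cong) auto
    moreover have "(\<lambda>S. of_bool (T \<subseteq> insert v S)) = (\<lambda>S. of_bool (T - {v} \<subseteq> S) :: real)"
      by (intro ext) auto
    moreover have "card T = Suc (card (T - {v}))"
      using True insert by (metis card.remove finite_insert rev_finite_subset)
    moreover have "T - {v} \<subseteq> V" using insert.prems by auto
    ultimately show ?thesis
      using insert by (simp add: biased_mean_insert biased_mean_const)
  next
    case False
    then have "(\<lambda>S. of_bool (T \<subseteq> insert v S)) = (\<lambda>S. of_bool (T \<subseteq> S) :: real)"
      by (intro ext) auto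
    moreover have "T \<subseteq> V" using insert.prems False by auto
    ultimately show ?thesis
      using insert by (simp add: biased_mean_insert algebra_simps)
  qed
qed

text \<open>The union of independent \<open>p\<close>- and \<open>q\<close>-biased sets is \<open>(p + q - p q)\<close>-biased, and it lies in a
  down-closed family only if both of them do.\<close>

lemma biased_mean_downset_mult:
  fixes D :: "'a set \<Rightarrow> bool"
  assumes "finite V" "0 \<le> p" "p \<le> 1" "0 \<le> q" "q \<le> 1"
    and "\<And>S S'. S \<subseteq> S' \<Longrightarrow> D S' \<Longrightarrow> D S"
  shows "biased_mean (p + q - p * q) V (\<lambda>S. of_bool (D S)) \<le>
    biased_mean p V (\<lambda>S. of_bool (D S)) * biased_mean q V (\<lambda>S. of_bool (D S))"
  using assms(1,6)
proof (induction V arbitrary: D)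
  case empty
  then show ?case by auto
next
  case (insert v V)
  let ?r = "p + q - p * q"
  let ?A = "\<lambda>p. biased_mean p V (\<lambda>S. of_bool (D S))"
  let ?B = "\<lambda>p. biased_mean p V (\<lambda>S. of_bool (D (insert v S)))"
  \<comment> \<open>The second identity splits the event that the union contains \<open>v\<close>:
    only the first set does, only the second, or both.\<close>
  have r: "1 - ?r = (1 - p) * (1 - q)" "?r = p * (1 - q) + q * (1 - p) + p * q"
    by (simp_all add: algebra_simps)
  have A: "?A ?r \<le> ?A p * ?A q" using insert.IH[of D] insert.prems by blast
  have B: "?B ?r \<le> ?B p * ?B q"
    
  proof (rule insert.IH)
    fix S S' assume "S \<subseteq> S'" "D (insert v S')"
    then show "D (insert v S)" using insert.prems[of "insert v S" "insert v S'"] by auto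
  qed
  have nonneg: "0 \<le> ?B p'" if "0 \<le> p'" "p' \<le> 1" for p'
    using that by (auto simp: biased_mean_def intro!: sum_nonneg mult_nonneg_nonneg)
  have BA: "?B p' \<le> ?A p'" if "0 \<le> p'" "p' \<le> 1" for p'
  proof (rule biased_mean_mono[OF that])
    fix S show "of_bool (D (insert v S)) \<le> (of_bool (D S) :: real)"
      using insert.prems[of S "insert v S"] by auto
  qed
  have "0 \<le> ?r" unfolding r(2) using assms by (intro add_nonneg_nonneg mult_nonneg_nonneg) auto
  have "(1 - ?r) * ?A ?r + ?r * ?B ?r \<le> (1 - ?r) * (?A p * ?A q) + ?r * (?B p * ?B q)"
    using A B \<open>0 \<le> ?r\<close> r(1) assms by (intro add_mono mult_left_mono) auto
  also have "\<dots> = (1 - p) * (1 - q) * (?A p * ?A q) + p * (1 - q) * (?B p * ?B q)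
      + q * (1 - p) * (?B p * ?B q) + p * q * (?B p * ?B q)"
    unfolding r(1) by (simp add: algebra_simps)
  \<comment> \<open>Down-closedness gives \<open>?B \<le> ?A\<close>. Where only one of the two sets
    contains \<open>v\<close>, the factor of the other is raised to \<open>?A\<close>, after which
    the sum is a product.\<close>
  also have "\<dots> \<le> (1 - p) * (1 - q) * (?A p * ?A q) + p * (1 - q) * (?B p * ?A q)
      + q * (1 - p) * (?A p * ?B q) + p * q * (?B p * ?B q)"
  proof -
    have "?B p * ?B q \<le> ?B p * ?A q" "?B p * ?B q \<le> ?A p * ?B q"
      using BA nonneg assms by (auto intro: mult_left_mono mult_right_mono)
    then have "p * (1 - q) * (?B p * ?B q) \<le> p * (1 - q) * (?B p * ?A q)"
      "q * (1 - p) * (?B p * ?B q) \<le> q * (1 - p) * (?A p * ?B q)"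
      using assms by (auto intro!: mult_left_mono)
    then show ?thesis by linarith
  qed
  also have "\<dots> = ((1 - p) * ?A p + p * ?B p) * ((1 - q) * ?A q + q * ?B q)"
    by (simp add: algebra_simps)
  finally show ?case
    using insert.hyps by (simp add: biased_mean_insert)
qed

text \<open>The union of \<open>m\<close> independent \<open>p\<close>-biased sets omits an element
  with probability \<open>(1 - p) ^ m\<close>, and it lies in a down-closed family only if all
  \<open>m\<close> sets do.\<close>

lemma biased_mean_downset_power:
  fixes D :: "'a set \<Rightarrow> bool"
  assumes "finite V" "0 \<le> p" "p \<le> 1"
    and D: "\<And>S S'. S \<subseteq> S' \<Longrightarrow> D S' \<Longrightarrow> D S"
  shows "biased_mean (1 - (1 - p) ^ m) V (\<lambda>S. of_bool (D S)) \<le>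
    biased_mean p V (\<lambda>S. of_bool (D S)) ^ m"
proof (induction m)
  case 0
  have "biased_mean 0 V (\<lambda>S. of_bool (D S)) \<le> biased_mean 0 V (\<lambda>S. 1)"
    by (rule biased_mean_mono) auto
  then show ?case using assms by (simp add: biased_mean_const)
next
  case (Suc m)
  let ?q = "1 - (1 - p) ^ m" and ?N = "\<lambda>p. biased_mean p V (\<lambda>S. of_bool (D S))"
  have q: "0 \<le> ?q" "?q \<le> 1" using assms by (auto simp: power_le_one)
  have eq: "1 - (1 - p) ^ Suc m = p + ?q - p * ?q" by (simp add: algebra_simps)
  have "?N (1 - (1 - p) ^ Suc m) \<le> ?N p * ?N ?q"
    unfolding eq by (rule biased_mean_downset_mult[OF assms(1-3) q]) (rule D)
  also have "\<dots> \<le> ?N p * ?N p ^ m"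
    using Suc.IH assms
    by (intro mult_left_mono) (auto simp: biased_mean_def intro!: sum_nonneg mult_nonneg_nonneg)
  finally show ?case by simp
qed

section \<open>Spread families and the second moment method\<close>

text \<open>Expand the product of \<open>card A\<close> factors \<open>1 + x\<close>: a subset
  \<open>U\<close> records the factors from which \<open>x\<close> is taken.\<close>

lemma sum_power_card_Pow:
  fixes x :: "'b :: comm_ring_1"
  assumes "finite A"
  shows "(\<Sum>U\<in>Pow A. x ^ card U) = (1 + x) ^ card A"
  using assms
proof (induction A)
  case empty
  then show ?case by simp
next
  case (insert a A)
  have inj: "inj_on (insert a) (Pow A)" using insert.hyps by (auto simp: inj_on_def)
  have "(\<Sum>U\<in>Pow (insert a A). x ^ card U) =
      (\<Sum>U\<in>Pow A. x ^ card U) + (\<Sum>U\<in>Pow A. x ^ card (insert a U))"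
    unfolding Pow_insert using insert.hyps inj
    by (subst sum.union_disjoint) (auto simp: sum.reindex)
  also have "(\<Sum>U\<in>Pow A. x ^ card (insert a U)) = (\<Sum>U\<in>Pow A. x * x ^ card U)"
  proof (rule sum.cong)
    fix U assume "U \<in> Pow A"
    then have "a \<notin> U" "finite U" using insert.hyps finite_subset by auto
    then show "x ^ card (insert a U) = x * x ^ card U" by simp
  qed simp
  also have "\<dots> = x * (\<Sum>U\<in>Pow A. x ^ card U)" by (simp add: sum_distrib_left)
  finally show ?case using insert by (simp add: algebra_simps)
qed

text \<open>Chebyshev's inequality for the number of members of \<open>H\<close> inside a \<open>p\<close>-biased set, a member \<open>h\<close>
  being counted with weight \<open>1 / p ^ card h\<close>.\<close>

lemma spread_family_second_moment:
  fixes H :: "'a set set" and p K :: real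
  assumes V: "finite V" and H: "H \<subseteq> Pow V" "H \<noteq> {}" and w: "\<And>h. h \<in> H \<Longrightarrow> card h \<le> w"
    and p: "0 < p" "p \<le> 1" and K: "K > 0"
    and spread: "\<And>U. real (card {h \<in> H. U \<subseteq> h}) * K ^ card U \<le> card H"
  shows "biased_mean p V (\<lambda>S. of_bool (\<forall>h\<in>H. \<not> h \<subseteq> S)) \<le> (1 + 1 / (p * K)) ^ w - 1"
proof -
  define N where "N = real (card H)"
  define X where "X = (\<lambda>S. \<Sum>h\<in>H. (1 / p ^ card h) * of_bool (h \<subseteq> S))"
  let ?E = "biased_mean p V"
  have finH: "finite H" using V H by (meson finite_Pow_iff finite_subset)
  have "N > 0" using finH H by (auto simp: N_def card_gt_0_iff)
  have sub: "h \<subseteq> V" if "h \<in> H" for h using H that by auto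
  \<comment> \<open>The weight \<open>1 / p ^ card h\<close> gives every member an expected
    contribution of 1.\<close>
  have EX: "?E X = N"
  proof -
    have "?E X = (\<Sum>h\<in>H. (1 / p ^ card h) * ?E (\<lambda>S. of_bool (h \<subseteq> S)))"
      unfolding X_def biased_mean_sum biased_mean_cmult ..
    also have "\<dots> = (\<Sum>h\<in>H. 1)"
      using V sub p by (intro sum.cong) (auto simp: biased_mean_superset)
    finally show ?thesis by (simp add: N_def)
  qed
  have pair: "(1 / p ^ card h) * (1 / p ^ card g) * ?E (\<lambda>S. of_bool (h \<union> g \<subseteq> S)) =
      (1 / p) ^ card (h \<inter> g)" if "h \<in> H" "g \<in> H" for h g
  proof -
    have fin: "finite h" "finite g" using sub that V by (meson finite_subset)+
    have "?E (\<lambda>S. of_bool (h \<union> g \<subseteq> S)) = p ^ card (h \<union> g)"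
      using V sub that by (intro biased_mean_superset) auto
    moreover have "p ^ card h * p ^ card g = p ^ card (h \<union> g) * p ^ card (h \<inter> g)"
      using card_Un_Int[OF fin] by (simp flip: power_add)
    ultimately show ?thesis using p by (simp add: field_simps)
  qed
  have row: "(\<Sum>g\<in>H. (1 / p) ^ card (h \<inter> g)) \<le> N * (1 + 1 / (p * K)) ^ w" if h: "h \<in> H" for h
  proof -
    have fin: "finite h" using sub h V by (meson finite_subset)
    \<comment> \<open>The inner sum has nonnegative terms and contains the left summand at
      \<open>U = h \<inter> g\<close>. Swapping the sums then counts the members that contain
      \<open>U\<close>, which is what \<open>spread\<close> bounds.\<close>
    have "(\<Sum>g\<in>H. (1 / p) ^ card (h \<inter> g)) \<le>
        (\<Sum>g\<in>H. \<Sum>U\<in>Pow h. (1 / p) ^ card U * of_bool (U \<subseteq> g))"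
    proof (rule sum_mono)
      fix g
      have "(1 / p) ^ card (h \<inter> g) = (\<Sum>U\<in>{h \<inter> g}. (1 / p) ^ card U * of_bool (U \<subseteq> g))"
        by simp
      also have "\<dots> \<le> (\<Sum>U\<in>Pow h. (1 / p) ^ card U * of_bool (U \<subseteq> g))"
        using fin p by (intro sum_mono2) auto
      finally show "(1 / p) ^ card (h \<inter> g) \<le> (\<Sum>U\<in>Pow h. (1 / p) ^ card U * of_bool (U \<subseteq> g))" .
    qed
    also have "\<dots> = (\<Sum>U\<in>Pow h. (1 / p) ^ card U * real (card {g \<in> H. U \<subseteq> g}))"
      using finH by (subst sum.swap) (simp add: sum_distrib_left[symmetric] Int_def)
    also have "\<dots> \<le> (\<Sum>U\<in>Pow h. N * (1 / (p * K)) ^ card U)"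
    proof (rule sum_mono)
      fix U
      have "real (card {g \<in> H. U \<subseteq> g}) \<le> N / K ^ card U"
        using spread[of U] K by (simp add: N_def field_simps)
      then have "(1 / p) ^ card U * real (card {g \<in> H. U \<subseteq> g}) \<le> (1 / p) ^ card U * (N / K ^ card U)"
        using p by (intro mult_left_mono) auto
      then show "(1 / p) ^ card U * real (card {g \<in> H. U \<subseteq> g}) \<le> N * (1 / (p * K)) ^ card U"
        by (simp add: field_simps power_mult_distrib)
    qed
    also have "\<dots> = N * (1 + 1 / (p * K)) ^ card h"
      using fin by (simp add: sum_power_card_Pow flip: sum_distrib_left)
    also have "\<dots> \<le> N * (1 + 1 / (p * K)) ^ w"
      using p K w[OF h] \<open>N > 0\<close> by (intro mult_left_mono power_increasing) auto
    finally show ?thesis .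
  qed
  have EX2: "?E (\<lambda>S. X S ^ 2) \<le> N ^ 2 * (1 + 1 / (p * K)) ^ w"
  proof -
    have "X S ^ 2 = (\<Sum>h\<in>H. \<Sum>g\<in>H. (1 / p ^ card h) * (1 / p ^ card g) * of_bool (h \<union> g \<subseteq> S))"
      for S
      unfolding X_def power2_eq_square sum_product by (intro sum.cong refl) auto
    then have "?E (\<lambda>S. X S ^ 2) = (\<Sum>h\<in>H. \<Sum>g\<in>H. (1 / p) ^ card (h \<inter> g))"
      by (simp only: biased_mean_sum biased_mean_cmult pair cong: sum.cong)
    also have "\<dots> \<le> (\<Sum>h\<in>H. N * (1 + 1 / (p * K)) ^ w)" by (intro sum_mono row)
    finally show ?thesis by (simp add: N_def power2_eq_square)
  qed
  have "N ^ 2 * ?E (\<lambda>S. of_bool (\<forall>h\<in>H. \<not> h \<subseteq> S)) =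
      ?E (\<lambda>S. N ^ 2 * of_bool (\<forall>h\<in>H. \<not> h \<subseteq> S))"
    by (simp add: biased_mean_cmult)
  \<comment> \<open>If \<open>S\<close> contains no member of \<open>H\<close>, then
    \<open>X S = 0\<close> and both sides are \<open>N ^ 2\<close>; otherwise the left side is 0.
    The right side is the square of \<open>X S - N\<close>, expanded so that linearity
    applies.\<close>
  also have "\<dots> \<le> ?E (\<lambda>S. X S ^ 2 + (- 2 * N) * X S + N ^ 2)"
  proof (rule biased_mean_mono)
    fix S
    show "N ^ 2 * of_bool (\<forall>h\<in>H. \<not> h \<subseteq> S) \<le> X S ^ 2 + (- 2 * N) * X S + N ^ 2"
    proof (cases "\<forall>h\<in>H. \<not> h \<subseteq> S")
      case True
      then have "X S = 0" by (simp add: X_def)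
      then show ?thesis using True by simp
    next
      case False
      then have "\<not> (\<forall>h\<in>H. \<not> h \<subseteq> S)" .
      moreover have "X S ^ 2 + (- 2 * N) * X S + N ^ 2 = (X S - N) ^ 2"
        by (simp add: power2_diff)
      ultimately show ?thesis by (simp only: of_bool_eq mult_zero_right) simp
    qed
  qed (use p in auto)
  also have "\<dots> = ?E (\<lambda>S. X S ^ 2) - N ^ 2"
    unfolding biased_mean_add biased_mean_cmult biased_mean_const[OF V] EX
    by (simp add: power2_eq_square)
  also have "\<dots> \<le> N ^ 2 * ((1 + 1 / (p * K)) ^ w - 1)"
    using EX2 by (simp add: algebra_simps)
  finally show ?thesis using \<open>N > 0\<close> by simp
qed


text \<open>A uniformly random set is the union of \<open>m\<close> independent \<open>p\<close>-biased ones, where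
  \<open>p = 1 - 2 powr (-1/m) \<ge> 1 / (2 m)\<close>, and each of these misses \<open>H\<close> with probability at most
  \<open>1/2\<close>.\<close>

lemma spread_family_miss_prob:
  fixes H :: "'a set set" and K :: real
  assumes V: "finite V" and H: "H \<subseteq> Pow V" "H \<noteq> {}" and w: "\<And>h. h \<in> H \<Longrightarrow> card h \<le> w"
    and "w \<ge> 1" "m \<ge> 1" and K: "K = real (6 * w * m)"
    and spread: "\<And>U. real (card {h \<in> H. U \<subseteq> h}) * K ^ card U \<le> card H"
  shows "biased_mean (1 / 2) V (\<lambda>S. of_bool (\<forall>h\<in>H. \<not> h \<subseteq> S)) \<le> (1 / 2) ^ m"
proof -
  define p :: real where "p = 1 - root m (1 / 2)"
  have m: "m > 0" using \<open>m \<ge> 1\<close> by simp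
  have root: "0 < root m (1 / 2)" "root m (1 / 2) < 1" "root m (1 / 2) ^ m = (1 / 2 :: real)"
    using m by simp_all
  have p: "0 < p" "p \<le> 1" using root by (simp_all add: p_def)
  \<comment> \<open>For smaller \<open>p\<close>, \<open>(1 - 1 / (2 * m)) ^ m\<close> would be
    below \<open>1 / 2\<close>, against Bernoulli's inequality.\<close>
  have p_ge: "p \<ge> 1 / (2 * m)"
  proof (rule ccontr)
    assume "\<not> p \<ge> 1 / (2 * m)"
    then have "1 - 1 / (2 * m) < root m (1 / 2)" by (simp add: p_def)
    moreover have "0 \<le> 1 - 1 / (2 * real m)" using m by (simp add: field_simps)
    ultimately have "(1 - 1 / (2 * m)) ^ m < (1 / 2 :: real)"
      using power_strict_mono[of "1 - 1 / (2 * m)" "root m (1 / 2)" m] m root(3) by simp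
    moreover have "1 + real m * (- (1 / (2 * m))) \<le> (1 + (- (1 / (2 * m)))) ^ m"
      using m by (intro Bernoulli_inequality) (simp add: field_simps)
    ultimately show False using m by (simp add: field_simps)
  qed
  have "K > 0" using K \<open>w \<ge> 1\<close> m by simp
  \<comment> \<open>The factor 6 in \<open>K\<close> serves this: it leaves \<open>3 * w\<close>, so
    that \<open>w / (p * K)\<close> is at most \<open>1 / 3\<close>.\<close>
  have pK: "p * K \<ge> 3 * w"
  proof -
    have "3 * real w = 1 / (2 * m) * K" using K m by (simp add: field_simps)
    also have "\<dots> \<le> p * K" using p_ge \<open>K > 0\<close> by (intro mult_right_mono) auto
    finally show ?thesis by simp
  qed
  define x :: real where "x = 1 / (p * K)"
  have x: "0 \<le> x" "w * x \<le> 1 / 3" "x \<le> 1"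
  proof -
    show "0 \<le> x" using p \<open>K > 0\<close> by (simp add: x_def)
    show *: "w * x \<le> 1 / 3" using pK p \<open>K > 0\<close> by (simp add: x_def field_simps)
    have "1 * x \<le> w * x" using \<open>0 \<le> x\<close> \<open>w \<ge> 1\<close> by (intro mult_right_mono) auto
    then show "x \<le> 1" using * by linarith
  qed
  \<comment> \<open>Bernoulli's inequality bounds powers from below, so it is applied to
    \<open>1 - x\<close>. With \<open>(1 - x) ^ w \<ge> 2 / 3\<close> and
    \<open>(1 + x) ^ w * (1 - x) ^ w \<le> 1\<close>, it follows that
    \<open>(1 + x) ^ w \<le> 3 / 2\<close>.\<close>
  have "(1 + x) ^ w * (2 / 3) \<le> (1 + x) ^ w * (1 - x) ^ w"
    using Bernoulli_inequality[of "- x" w] x by (intro mult_left_mono) auto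
  also have "\<dots> = (1 - x ^ 2) ^ w"
    by (simp add: power_mult_distrib[symmetric] algebra_simps power2_eq_square)
  also have "\<dots> \<le> 1" using x by (intro power_le_one) (auto simp: abs_square_le_1)
  finally have half: "(1 + x) ^ w - 1 \<le> 1 / 2" by simp
  let ?D = "\<lambda>S. \<forall>h\<in>H. \<not> h \<subseteq> S"
  have "biased_mean p V (\<lambda>S. of_bool (?D S)) \<le> (1 + x) ^ w - 1"
    unfolding x_def by (rule spread_family_second_moment) (use assms p \<open>K > 0\<close> in auto)
  with half have miss: "biased_mean p V (\<lambda>S. of_bool (?D S)) \<le> 1 / 2" by linarith
  have "biased_mean (1 - (1 - p) ^ m) V (\<lambda>S. of_bool (?D S)) \<le>
      biased_mean p V (\<lambda>S. of_bool (?D S)) ^ m"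
    by (rule biased_mean_downset_power) (use V p in auto)
  also have "\<dots> \<le> (1 / 2) ^ m"
    using miss p by (intro power_mono) (auto simp: biased_mean_def intro!: sum_nonneg)
  finally show ?thesis using root(3) by (simp add: p_def)
qed

section \<open>Approximate sunflowers\<close>

text \<open>\<open>T\<close> is a heavy set of largest cardinality, and \<open>B\<close> consists of
  the members above it. For nonempty \<open>U\<close> disjoint from \<open>T\<close>, the set
  \<open>T \<union> U\<close> is no longer heavy, which yields the spread condition for the sets
  \<open>h - T\<close>.\<close>

lemma approximate_sunflower:
  fixes A :: "'a set set" and K :: real
  assumes V: "finite V" and A: "A \<subseteq> Pow V" and w: "\<forall>h\<in>A. card h \<le> w"
    and "w \<ge> 1" "m \<ge> 1" and K: "K = real (6 * w * m)"
    and large: "real (card A) > K ^ w"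
  obtains T B where "B \<subseteq> A" "card B \<ge> 2" "\<forall>h\<in>B. T \<subseteq> h"
    "biased_mean (1 / 2) V (\<lambda>S. of_bool (T \<subseteq> S \<and> (\<forall>h\<in>B. \<not> h \<subseteq> S))) \<le> (1 / 2) ^ m"
proof -
  have "6 * w * m \<ge> 1" using \<open>w \<ge> 1\<close> \<open>m \<ge> 1\<close> by simp
  then have "K \<ge> 1" unfolding K by (simp only: of_nat_1 flip: of_nat_le_iff[where 'a = real])
  have finA: "finite A" using V A by (meson finite_Pow_iff finite_subset)
  define heavy where "heavy = (\<lambda>T. real (card {h \<in> A. T \<subseteq> h}) * K ^ card T \<ge> card A)"
  have A0: "real (card A) > 0" using large \<open>K \<ge> 1\<close> by (smt (verit) zero_le_power)
  have sub: "\<exists>h\<in>A. T \<subseteq> h" if "heavy T" for T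
  proof (rule ccontr)
    assume "\<not> ?thesis"
    then have "{h \<in> A. T \<subseteq> h} = {}" by blast
    then have "card {h \<in> A. T \<subseteq> h} = 0" by (simp only: card.empty)
    then show False using that A0 unfolding heavy_def by (simp only: of_nat_0 mult_zero_left)
  qed
  have fin: "finite h" if "h \<in> A" for h using A V that by (meson PowD finite_subset subsetD)
  have heavy_card: "card T \<le> w" if "heavy T" for T
    using sub[OF that] w fin by (meson card_mono order_trans)
  have "heavy {}" by (simp add: heavy_def)
  moreover have "\<forall>T. heavy T \<longrightarrow> card T < Suc w" using heavy_card by (simp add: less_Suc_eq_le)
  ultimately obtain T where T: "heavy T" "\<And>T'. heavy T' \<Longrightarrow> card T' \<le> card T"
    using ex_has_greatest_nat[of heavy "{}" card "Suc w"] by blast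
  define B where "B = {h \<in> A. T \<subseteq> h}"
  define H where "H = (\<lambda>h. h - T) ` B"
  have finT: "finite T" using sub[OF T(1)] fin finite_subset by blast
  have B0: "real (card B) * K ^ card T \<ge> card A" using T(1) by (simp add: heavy_def B_def)
  \<comment> \<open>Heaviness gives \<open>card B * K ^ card T \<ge> card A > K ^ w\<close>, so one
    member is too few. Two ensure that replacing \<open>B\<close> by a single term shrinks a
    formula.\<close>
  have "card B \<ge> 2"
  proof (rule ccontr)
    assume "\<not> ?thesis"
    then have "real (card B) * K ^ card T \<le> 1 * K ^ card T"
      using \<open>K \<ge> 1\<close> by (intro mult_right_mono) auto
    also have "\<dots> \<le> K ^ w" using \<open>K \<ge> 1\<close> heavy_card[OF T(1)] by (simp add: power_increasing)
    finally show False using B0 large by linarith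
  qed
  have inj: "inj_on (\<lambda>h. h - T) B" by (auto simp: inj_on_def B_def)
  then have cardH: "card H = card B" by (simp add: H_def card_image)
  have spread: "real (card {h \<in> H. U \<subseteq> h}) * K ^ card U \<le> card H" for U
  \<comment> \<open>A \<open>U\<close> inside no member makes the left side 0. This covers infinite
    \<open>U\<close>, where \<open>card U\<close> is 0 by convention.\<close>
  proof (cases "U = {} \<or> {h \<in> H. U \<subseteq> h} = {}")
    case True
    then show ?thesis
    proof
      assume "{h \<in> H. U \<subseteq> h} = {}"
      then show ?thesis by (simp only: card.empty of_nat_0 mult_zero_left of_nat_0_le_iff)
    qed simp
  next
    case False
    then obtain h0 where h0: "h0 \<in> B" "U \<subseteq> h0 - T" by (auto simp: H_def)
    have "finite U" using h0 fin by (auto simp: B_def intro: finite_subset)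
    have disj: "U \<inter> T = {}" using h0 by auto
    have card_TU: "card (T \<union> U) = card T + card U"
      using finT \<open>finite U\<close> disj by (subst card_Un_disjoint) auto
    have "card U > 0" using \<open>finite U\<close> False by (simp add: card_gt_0_iff)
    then have "\<not> heavy (T \<union> U)" using T(2)[of "T \<union> U"] card_TU by linarith
    then have "real (card {h \<in> A. T \<union> U \<subseteq> h}) * K ^ card U * K ^ card T \<le> card B * K ^ card T"
      using B0 by (simp add: heavy_def card_TU power_add mult_ac)
    then have "real (card {h \<in> A. T \<union> U \<subseteq> h}) * K ^ card U \<le> card B"
      using \<open>K \<ge> 1\<close> by (simp add: mult_le_cancel_right)
    moreover have "{h \<in> H. U \<subseteq> h} = (\<lambda>h. h - T) ` {h \<in> A. T \<union> U \<subseteq> h}"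
      using disj by (auto simp: H_def B_def)
    then have "card {h \<in> H. U \<subseteq> h} \<le> card {h \<in> A. T \<union> U \<subseteq> h}"
      using finA by (simp add: card_image_le)
    then have "real (card {h \<in> H. U \<subseteq> h}) * K ^ card U \<le>
        real (card {h \<in> A. T \<union> U \<subseteq> h}) * K ^ card U"
      using \<open>K \<ge> 1\<close> by (intro mult_right_mono) auto
    ultimately show ?thesis using cardH by linarith
  qed
  have "biased_mean (1 / 2) V (\<lambda>S. of_bool (T \<subseteq> S \<and> (\<forall>h\<in>B. \<not> h \<subseteq> S))) \<le>
      biased_mean (1 / 2) V (\<lambda>S. of_bool (\<forall>h\<in>H. \<not> h \<subseteq> S))"
  proof (rule biased_mean_mono)
    fix S
    have "T \<subseteq> S \<and> (\<forall>h\<in>B. \<not> h \<subseteq> S) \<longrightarrow> (\<forall>h\<in>H. \<not> h \<subseteq> S)"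
      unfolding H_def by blast
    then show "of_bool (T \<subseteq> S \<and> (\<forall>h\<in>B. \<not> h \<subseteq> S)) \<le> (of_bool (\<forall>h\<in>H. \<not> h \<subseteq> S) :: real)"
      unfolding of_bool_less_eq_iff .
  qed simp_all
  also have "\<dots> \<le> (1 / 2) ^ m"
  proof (rule spread_family_miss_prob[OF V _ _ _ \<open>w \<ge> 1\<close> \<open>m \<ge> 1\<close> K spread])
    show "H \<subseteq> Pow V" using A by (auto simp: H_def B_def)
    show "H \<noteq> {}" using \<open>card B \<ge> 2\<close> by (auto simp: H_def)
    show "card h \<le> w" if h: "h \<in> H" for h
    proof -
      obtain g where "g \<in> A" "h \<subseteq> g" using h by (auto simp: H_def B_def)
      then show ?thesis using w fin by (meson card_mono order_trans)
    qed
  qed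
  finally show thesis
    by (rule that[OF _ \<open>card B \<ge> 2\<close>, rotated 2]) (auto simp: B_def)
qed

section \<open>From points of the cube to random subsets of the coordinates\<close>

lemma finite_cube: "finite (cube n)" and card_cube: "card (cube n) = 2 ^ n"
  by (simp_all add: cube_def finite_PiE card_PiE)

text \<open>Recording where \<open>x\<close> agrees with a fixed \<open>y\<close> is a bijection
  from the cube onto the subsets of \<open>{..<n}\<close>, so a uniform point becomes a
  \<open>1 / 2\<close>-biased set, all subsets having the same weight.\<close>

lemma card_cube_agreement:
  "real (card {x \<in> cube n. P {i. i < n \<and> x i = y i}}) =
    2 ^ n * biased_mean (1 / 2) {..<n} (\<lambda>S. of_bool (P S))"
proof -
  let ?f = "\<lambda>x :: nat \<Rightarrow> bool. {i. i < n \<and> x i = y i}"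
  have bij: "bij_betw ?f (cube n) (Pow {..<n})"
  proof (rule bij_betw_byWitness[where f' = "\<lambda>S. \<lambda>i\<in>{..<n}. (i \<in> S) = y i"])
    show "\<forall>x\<in>cube n. (\<lambda>i\<in>{..<n}. (i \<in> ?f x) = y i) = x"
      by (auto simp: cube_def PiE_def extensional_def fun_eq_iff)
  qed (auto simp: cube_def)
  have "2 ^ n * biased_mean (1 / 2) {..<n} (\<lambda>S. of_bool (P S)) =
      (\<Sum>S\<in>Pow {..<n}. of_bool (P S))"
    unfolding biased_mean_def sum_distrib_left
  proof (rule sum.cong)
    fix S assume "S \<in> Pow {..<n}"
    then have "card S + card ({..<n} - S) = n"
      by (metis PowD card_lessThan card_mono card_Diff_subset finite_lessThan finite_subset
          le_add_diff_inverse)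
    then have "(1 / 2 :: real) ^ card S * (1 - 1 / 2) ^ card ({..<n} - S) = (1 / 2) ^ n"
      by (simp flip: power_add)
    then show "2 ^ n * ((1 / 2) ^ card S * (1 - 1 / 2) ^ card ({..<n} - S) * of_bool (P S)) =
        (of_bool (P S) :: real)"
      by (simp add: power_divide)
  qed simp
  also have "\<dots> = (\<Sum>x\<in>cube n. of_bool (P (?f x)))"
    using sum.reindex_bij_betw[OF bij] by (rule sym)
  also have "\<dots> = real (card {x \<in> cube n. P (?f x)})"
    by (simp add: Int_def finite_cube)
  finally show ?thesis ..
qed

lemma eval_literal_iff_agree:
  "eval_literal l y \<Longrightarrow> eval_literal l x \<longleftrightarrow> x (var l) = y (var l)"
  by (cases l) auto

text \<open>Relative to a point \<open>y\<close> that satisfies \<open>t\<close>, negations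
  disappear: \<open>t\<close> asks only for agreement with \<open>y\<close> on its
  variables.\<close>

lemma eval_term_iff_agree:
  assumes "eval_term t y" "\<And>l. l \<in> t \<Longrightarrow> var l < n"
  shows "eval_term t x \<longleftrightarrow> var ` t \<subseteq> {i. i < n \<and> x i = y i}"
  using assms eval_literal_iff_agree[of _ y x] unfolding eval_term_def by blast

lemma finite_literals: "finite {l. var l < n}" and card_literals: "card {l. var l < n} = 2 * n"
proof -
  have eq: "{l. var l < n} = Pos ` {..<n} \<union> Neg ` {..<n}"
  proof (intro set_eqI)
    fix l show "l \<in> {l. var l < n} \<longleftrightarrow> l \<in> Pos ` {..<n} \<union> Neg ` {..<n}" by (cases l) auto
  qed
  show "finite {l. var l < n}" unfolding eq by simp
  show "card {l. var l < n} = 2 * n"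
    unfolding eq by (subst card_Un_disjoint) (auto simp: card_image inj_on_def)
qed

lemma card_satisfying_term:
  assumes "eval_term t y" "\<And>l. l \<in> t \<Longrightarrow> var l < n"
  shows "real (card {x \<in> cube n. eval_term t x}) \<ge> 2 ^ n / 2 ^ card t"
proof -
  have "finite t" using assms(2) by (intro finite_subset[OF _ finite_literals[of n]]) auto
  have "eval_term t x \<longleftrightarrow> var ` t \<subseteq> {i. i < n \<and> x i = y i}" for x
    using assms by (rule eval_term_iff_agree)
  then have "real (card {x \<in> cube n. eval_term t x}) =
      2 ^ n * biased_mean (1 / 2) {..<n} (\<lambda>S. of_bool (var ` t \<subseteq> S))"
    by (simp only: card_cube_agreement)
  also have "biased_mean (1 / 2) {..<n} (\<lambda>S. of_bool (var ` t \<subseteq> S)) = (1 / 2) ^ card (var ` t)"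
    using assms(2) by (intro biased_mean_superset) auto
  also have "2 ^ n * (1 / 2) ^ card (var ` t) \<ge> (2 ^ n * (1 / 2) ^ card t :: real)"
    using \<open>finite t\<close> by (intro mult_left_mono power_decreasing card_image_le) auto
  finally show ?thesis by (simp add: power_divide)
qed


section \<open>Approximate sunflowers in DNF formulas, and sparsification\<close>

text \<open>Makes \<open>var\<close> injective on the literals true at \<open>y\<close>, so that a
  term true at \<open>y\<close> can be recovered from its variables.\<close>

lemma literal_eqI:
  "eval_literal l y \<Longrightarrow> eval_literal l' y \<Longrightarrow> var l = var l' \<Longrightarrow> l = l'"
  by (cases l; cases l') auto

text \<open>Each satisfiable term of width at most \<open>w\<close> holds at a fraction \<open>2^(-w)\<close> of all points \<open>y\<close>. Hence
  some \<open>y\<close> satisfies a fraction \<open>2^(-w)\<close> of the terms, and these terms become monotone after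
  the substitution \<open>x i \<mapsto> (x i = y i)\<close>.\<close>

lemma dnf_approximate_sunflower:
  fixes F :: dnf and K :: real
  assumes on: "dnf_on n F" and sat: "\<forall>t\<in>F. \<exists>y. eval_term t y"
    and w: "\<forall>t\<in>F. card t \<le> w"
    and "w \<ge> 1" "m \<ge> 1" and K: "K = real (6 * w * m)"
    and large: "real (card F) > (2 * K) ^ w"
  obtains t0 B where "B \<subseteq> F" "card B \<ge> 2" "\<forall>t\<in>B. t0 \<subseteq> t"
    "real (card {x \<in> cube n. eval_term t0 x \<and> \<not> eval_dnf B x}) \<le> 2 ^ n / 2 ^ m"
proof -
  have varn: "var l < n" if "t \<in> F" "l \<in> t" for t l using on that by (auto simp: dnf_on_def)
  then have "F \<subseteq> Pow {l. var l < n}" by blast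
  then have finF: "finite F" using finite_literals by (meson finite_Pow_iff finite_subset)
  \<comment> \<open>Otherwise count the pairs of a term and a point satisfying it: summed over
    points, they are fewer than \<open>2 ^ n * card F / 2 ^ w\<close>; summed over terms, at least
    that many.\<close>
  have "\<exists>y\<in>cube n. real (card {t \<in> F. eval_term t y}) \<ge> card F / 2 ^ w"
  proof (rule ccontr)
    assume "\<not> ?thesis"
    then have less: "real (card {t \<in> F. eval_term t y}) < card F / 2 ^ w" if "y \<in> cube n" for y
      using that by force
    have "(\<Sum>y\<in>cube n. real (card {t \<in> F. eval_term t y})) < card (cube n) * (card F / 2 ^ w)"
      using less by (intro sum_bounded_above_strict) (auto simp: card_cube)
    moreover have "(\<Sum>y\<in>cube n. real (card {t \<in> F. eval_term t y})) =
        (\<Sum>y\<in>cube n. \<Sum>t\<in>F. of_bool (eval_term t y))"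
      using finF by (simp add: Int_def)
    moreover have "\<dots> = (\<Sum>t\<in>F. \<Sum>y\<in>cube n. of_bool (eval_term t y))" by (rule sum.swap)
    moreover have "\<dots> = (\<Sum>t\<in>F. real (card {y \<in> cube n. eval_term t y}))"
      by (simp add: Int_def finite_cube)
    moreover have "\<dots> \<ge> (\<Sum>t\<in>F. 2 ^ n / 2 ^ w)"
    proof (rule sum_mono)
      fix t assume t: "t \<in> F"
      obtain y where "eval_term t y" using sat t by blast
      then have "2 ^ n / 2 ^ card t \<le> real (card {y \<in> cube n. eval_term t y})"
        by (rule card_satisfying_term) (use varn t in blast)
      moreover have "(2 ^ n / 2 ^ w :: real) \<le> 2 ^ n / 2 ^ card t"
        using w t by (intro divide_left_mono power_increasing) auto
      ultimately show "2 ^ n / 2 ^ w \<le> real (card {y \<in> cube n. eval_term t y})" by linarith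
    qed
    ultimately show False by (simp add: card_cube mult.commute)
  qed
  then obtain y where y: "real (card {t \<in> F. eval_term t y}) \<ge> card F / 2 ^ w" by blast
  define F' where "F' = {t \<in> F. eval_term t y}"
  define A where "A = (`) var ` F'"
  have inj: "inj_on ((`) var) F'"
  proof (rule inj_onI)
    fix s t assume st: "s \<in> F'" "t \<in> F'" "var ` s = var ` t"
    then have "eval_literal l y" if "l \<in> s \<union> t" for l
      using that by (auto simp: F'_def eval_term_def)
    then have "inj_on var (s \<union> t)" by (auto intro!: inj_onI literal_eqI)
    then show "s = t" using st(3) by (simp add: inj_on_image_eq_iff[of var "s \<union> t"])
  qed
  \<comment> \<open>The factor \<open>2 ^ w\<close> lost in choosing \<open>y\<close> is why
    \<open>large\<close> has \<open>2 * K\<close> in place of \<open>K\<close>.\<close>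
  have "K ^ w * 2 ^ w < card F" using large by (simp add: power_mult_distrib mult.commute)
  then have "K ^ w < card F / 2 ^ w" by (simp add: field_simps)
  then have cardA: "real (card A) > K ^ w" using y inj by (simp add: A_def card_image F'_def)
  have A: "A \<subseteq> Pow {..<n}" using varn by (auto simp: A_def F'_def)
  have wA: "\<forall>h\<in>A. card h \<le> w"
  proof
    fix h assume "h \<in> A"
    then obtain t where t: "t \<in> F" "h = var ` t" unfolding A_def F'_def by blast
    then have "finite t" using varn by (intro finite_subset[OF _ finite_literals[of n]]) auto
    then show "card h \<le> w" using t w card_image_le[of t var] by force
  qed
  obtain T B where B: "B \<subseteq> A" "card B \<ge> 2" "\<forall>h\<in>B. T \<subseteq> h"
    and miss: "biased_mean (1 / 2) {..<n} (\<lambda>S. of_bool (T \<subseteq> S \<and> (\<forall>h\<in>B. \<not> h \<subseteq> S))) \<le> (1 / 2) ^ m"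
    by (rule approximate_sunflower[OF finite_lessThan A wA \<open>w \<ge> 1\<close> \<open>m \<ge> 1\<close> K cardA])
  \<comment> \<open>The kernel \<open>T\<close> is turned back into a term by giving each variable
    the sign that is true at \<open>y\<close>.\<close>
  define t0 where "t0 = {l. var l \<in> T \<and> eval_literal l y}"
  define B' where "B' = {t \<in> F'. var ` t \<in> B}"
  have B_eq: "B = (`) var ` B'" using B(1) by (auto simp: A_def B'_def)
  have "inj_on ((`) var) B'" using inj by (rule inj_on_subset) (auto simp: B'_def)
  then have card_B': "card B' \<ge> 2" using B(2) by (simp add: B_eq card_image)
  have t0_sub: "t0 \<subseteq> t" if t: "t \<in> B'" for t
  proof
    fix l assume l: "l \<in> t0"
    then have "var l \<in> var ` t" using B(3) t by (auto simp: t0_def B'_def)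
    then obtain l' where "l' \<in> t" "var l = var l'" by auto
    moreover from this have "eval_literal l' y" using t by (auto simp: B'_def F'_def eval_term_def)
    ultimately show "l \<in> t" using l literal_eqI[of l y l'] by (auto simp: t0_def)
  qed
  have "var ` t0 = T"
  proof (intro equalityI subsetI)
    fix i assume "i \<in> T"
    then have "(if y i then Pos i else Neg i) \<in> t0" by (simp add: t0_def)
    then show "i \<in> var ` t0" by (intro image_eqI[where x = "if y i then Pos i else Neg i"]) auto
  qed (auto simp: t0_def)
  have "B' \<noteq> {}" using card_B' by auto
  then obtain t1 where "t1 \<in> B'" by blast
  have "var l < n" if "l \<in> t0" for l
    using that t0_sub[OF \<open>t1 \<in> B'\<close>] varn[of t1 l] \<open>t1 \<in> B'\<close> by (auto simp: B'_def F'_def)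
  then have "eval_term t0 x \<longleftrightarrow> var ` t0 \<subseteq> {i. i < n \<and> x i = y i}" for x
    by (intro eval_term_iff_agree) (auto simp: t0_def eval_term_def)
  moreover have "eval_dnf B' x \<longleftrightarrow> (\<exists>h\<in>B. h \<subseteq> {i. i < n \<and> x i = y i})" for x
  proof -
    have "eval_term t x \<longleftrightarrow> var ` t \<subseteq> {i. i < n \<and> x i = y i}" if "t \<in> B'" for t
      using that varn by (intro eval_term_iff_agree) (auto simp: B'_def F'_def)
    then have "eval_dnf B' x \<longleftrightarrow> (\<exists>t\<in>B'. var ` t \<subseteq> {i. i < n \<and> x i = y i})"
      by (simp only: eval_dnf_def cong: bex_cong)
    moreover have "(\<exists>t\<in>B'. P (var ` t)) \<longleftrightarrow> (\<exists>h\<in>B. P h)" for P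
      unfolding B_eq by blast
    ultimately show ?thesis by (simp only:)
  qed
  ultimately have "{x \<in> cube n. eval_term t0 x \<and> \<not> eval_dnf B' x} =
      {x \<in> cube n. T \<subseteq> {i. i < n \<and> x i = y i} \<and> (\<forall>h\<in>B. \<not> h \<subseteq> {i. i < n \<and> x i = y i})}"
    by (simp only: \<open>var ` t0 = T\<close> Set.bex_simps)
  then have "real (card {x \<in> cube n. eval_term t0 x \<and> \<not> eval_dnf B' x}) =
      2 ^ n * biased_mean (1 / 2) {..<n} (\<lambda>S. of_bool (T \<subseteq> S \<and> (\<forall>h\<in>B. \<not> h \<subseteq> S)))"
    using card_cube_agreement[of n "\<lambda>S. T \<subseteq> S \<and> (\<forall>h\<in>B. \<not> h \<subseteq> S)" y] by (simp only:)
  also have "\<dots> \<le> 2 ^ n * (1 / 2) ^ m" by (intro mult_left_mono miss) simp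
  also have "\<dots> = 2 ^ n / 2 ^ m" by (simp add: power_divide)
  finally have "real (card {x \<in> cube n. eval_term t0 x \<and> \<not> eval_dnf B' x}) \<le> 2 ^ n / 2 ^ m" .
  moreover have "B' \<subseteq> F" "\<forall>t\<in>B'. t0 \<subseteq> t" using t0_sub by (auto simp: B'_def F'_def)
  ultimately show thesis using that card_B' by blast
qed

text \<open>Strong induction on the number of terms: while there are more than
  \<open>(2 * K) ^ w\<close>, the terms in \<open>B\<close> are replaced by their common subset
  \<open>t0\<close>. A round costs at most \<open>2 ^ n / 2 ^ m\<close> points and removes at least
  one term, so \<open>card F\<close> bounds the number of rounds.\<close>

lemma dnf_sparsification:
  fixes F :: dnf and K :: real
  assumes "dnf_on n F" "\<forall>t\<in>F. \<exists>y. eval_term t y" "\<forall>t\<in>F. card t \<le> w"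
    and "w \<ge> 1" "m \<ge> 1" and K: "K = real (6 * w * m)"
  shows "\<exists>G. dnf_on n G \<and> (\<forall>t\<in>G. card t \<le> w) \<and> real (card G) \<le> (2 * K) ^ w \<and>
    real (card {x \<in> cube n. eval_dnf F x \<noteq> eval_dnf G x}) \<le> card F * (2 ^ n / 2 ^ m)"
  using assms(1-3)
proof (induction "card F" arbitrary: F rule: less_induct)
  case less
  show ?case
  proof (cases "real (card F) \<le> (2 * K) ^ w")
    case True
    then show ?thesis using less.prems by (intro exI[of _ F]) auto
  next
    case False
    have "F \<subseteq> Pow {l. var l < n}" using less.prems(1) by (auto simp: dnf_on_def)
    then have finF: "finite F" using finite_literals by (meson finite_Pow_iff finite_subset)
    have large: "(2 * K) ^ w < card F" using False by simp
    obtain t0 B where B: "B \<subseteq> F" "card B \<ge> 2" and t0: "\<forall>t\<in>B. t0 \<subseteq> t"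
      and miss: "real (card {x \<in> cube n. eval_term t0 x \<and> \<not> eval_dnf B x}) \<le> 2 ^ n / 2 ^ m"
      by (rule dnf_approximate_sunflower[OF less.prems assms(4-6) large])
    define F' where "F' = insert t0 (F - B)"
    have "B \<noteq> {}" using B by auto
    then obtain t1 where t1: "t1 \<in> B" by blast
    have t1F: "t1 \<in> F" using t1 B by blast
    have fin1: "finite t1"
      using \<open>F \<subseteq> Pow {l. var l < n}\<close> t1F finite_literals[of n] by (meson PowD finite_subset subsetD)
    have "card F' \<le> Suc (card (F - B))" unfolding F'_def using finF by (simp add: card_insert_if)
    also have "card (F - B) = card F - card B"
      using B finF by (meson card_Diff_subset finite_subset)
    finally have "card F' \<le> Suc (card F - card B)" .
    moreover have "card B \<le> card F" using B finF by (simp add: card_mono)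
    ultimately have cardF': "card F' + 1 \<le> card F" using B(2) by linarith
    \<comment> \<open>The new term is a subset of \<open>t1\<close>, a term of \<open>F\<close>, and
      inherits its variables, satisfiability and width bound.\<close>
    have on': "dnf_on n F'"
      using less.prems(1) bspec[OF t0 t1] t1F by (auto simp: dnf_on_def F'_def)
    have sat': "\<forall>t\<in>F'. \<exists>y. eval_term t y"
      using less.prems(2) bspec[OF t0 t1] t1F unfolding F'_def eval_term_def by blast
    have w': "\<forall>t\<in>F'. card t \<le> w"
      using less.prems(3) card_mono[OF fin1 bspec[OF t0 t1]] t1F by (force simp: F'_def)
    obtain G where G: "dnf_on n G" "\<forall>t\<in>G. card t \<le> w" "real (card G) \<le> (2 * K) ^ w"
      and err: "real (card {x \<in> cube n. eval_dnf F' x \<noteq> eval_dnf G x}) \<le> card F' * (2 ^ n / 2 ^ m)"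
      using less.hyps[of F'] cardF' on' sat' w' by auto
    \<comment> \<open>Every term of \<open>B\<close> implies \<open>t0\<close>, so the replacement
      can only turn false into true, and only where \<open>t0\<close> holds and \<open>B\<close>
      fails.\<close>
    have "eval_term t0 x" if "t \<in> B" "eval_term t x" for t x
      using bspec[OF t0 that(1)] that(2) by (auto simp: eval_term_def)
    then have "{x \<in> cube n. eval_dnf F x \<noteq> eval_dnf G x} \<subseteq>
        {x \<in> cube n. eval_term t0 x \<and> \<not> eval_dnf B x} \<union>
        {x \<in> cube n. eval_dnf F' x \<noteq> eval_dnf G x}"
      using B(1) unfolding eval_dnf_def F'_def by blast
    then have "card {x \<in> cube n. eval_dnf F x \<noteq> eval_dnf G x} \<le>
        card {x \<in> cube n. eval_term t0 x \<and> \<not> eval_dnf B x} +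
        card {x \<in> cube n. eval_dnf F' x \<noteq> eval_dnf G x}"
      by (intro order_trans[OF card_mono card_Un_le]) (auto simp: finite_cube)
    then have "real (card {x \<in> cube n. eval_dnf F x \<noteq> eval_dnf G x}) \<le>
        2 ^ n / 2 ^ m + card F' * (2 ^ n / 2 ^ m)"
      using miss err by linarith
    also have "\<dots> = real (card F' + 1) * (2 ^ n / 2 ^ m)" by (simp add: algebra_simps add_divide_distrib)
    also have "\<dots> \<le> card F * (2 ^ n / 2 ^ m)"
      using cardF' by (intro mult_right_mono) (simp_all only: of_nat_le_iff, simp)
    finally show ?thesis using G by blast
  qed
qed

section \<open>Counting terms and choosing the constants\<close>

text \<open>Each term is listed by at most \<open>w\<close> of the \<open>2 * n\<close> literals;
  the numbers of such lists form a geometric sum.\<close>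

lemma card_dnf_le:
  assumes "dnf_on n F" "\<And>t. t \<in> F \<Longrightarrow> card t \<le> w" "n \<ge> 1"
  shows "card F \<le> (2 * n) ^ Suc w"
proof -
  let ?L = "{l. var l < n}"
  let ?X = "{xs. set xs \<subseteq> ?L \<and> length xs \<le> w}"
  have "F \<subseteq> set ` ?X"
  proof
    fix t assume t: "t \<in> F"
    then have "t \<subseteq> ?L" using assms(1) by (auto simp: dnf_on_def)
    then have "finite t" using finite_literals finite_subset by blast
    then obtain xs where "set xs = t" "length xs = card t"
      using finite_distinct_list distinct_card by metis
    then show "t \<in> set ` ?X" using \<open>t \<subseteq> ?L\<close> assms(2)[OF t] by auto
  qed
  moreover have "finite ?X" using finite_literals by (rule finite_lists_length_le)
  ultimately have "card F \<le> card ?X"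
    using card_mono[of "set ` ?X" F] card_image_le[of ?X set] by simp
  also have "\<dots> = (\<Sum>i\<le>w. (2 * n) ^ i)"
    using card_lists_length_le[OF finite_literals[of n]] by (simp add: card_literals)
  also have "\<dots> \<le> (2 * n) ^ Suc w"
  proof -
    have "(\<Sum>i\<le>w. b ^ i) \<le> b ^ Suc w" if "b \<ge> 2" for b :: nat
    proof (induction w)
      case (Suc w)
      have "2 * b ^ Suc w \<le> b * b ^ Suc w" using that by (intro mult_right_mono) auto
      moreover have "(\<Sum>i\<le>Suc w. b ^ i) = (\<Sum>i\<le>w. b ^ i) + b ^ Suc w" by simp
      moreover have "b ^ Suc (Suc w) = b * b ^ Suc w" by simp
      ultimately show ?case using Suc by linarith
    qed (use that in simp)
    then show ?thesis using assms(3) by (metis mult_le_mono2 mult.right_neutral)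
  qed
  finally show ?thesis .
qed

theorem corollary1p3:
  fixes a c :: real
  assumes "a > 0" and "c > 0"
  shows "\<exists>C::real. C > 0 \<and>
    (\<forall>n::nat. n \<ge> 2 \<longrightarrow>
      (\<forall>f :: (nat \<Rightarrow> bool) \<Rightarrow> bool.
        (\<exists>F. computes n F f \<and> real (dnf_width F) \<le> a * lg (real n)) \<longrightarrow>
        (\<exists>G. dnf_on n G \<and>
             real (dnf_width G) \<le> C * lg (real n) \<and>
             real (card G) \<le> real n powr (C * lg (lg (real n))) \<and>
             measure_pmf.prob (pmf_of_set (cube n)) {x. f x \<noteq> eval_dnf G x}
               \<le> real n powr (- c))))"
proof -
  \<comment> \<open>\<open>D * L ^ 3\<close> will bound \<open>2 * K = 12 * w * m\<close>, from
    \<open>w \<le> (a + 1) * L\<close> and \<open>m \<le> (2 * a + c + 5) * L ^ 2\<close>. In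
    \<open>C\<close>, the factor \<open>log 2 D + 3\<close> comes from the logarithm of
    \<open>D * L ^ 3\<close>, \<open>a + 1\<close> from \<open>w\<close>, and 2 from
    \<open>L \<le> 2 * l\<close>.\<close>
  define D where "D = 12 * (a + 1) * (2 * a + c + 5)"
  define C where "C = 2 * (a + 1) * (log 2 D + 3)"
  have "1 * 1 \<le> (a + 1) * (2 * a + c + 5)" using assms by (intro mult_mono) auto
  moreover have "D = 12 * ((a + 1) * (2 * a + c + 5))" by (simp add: D_def)
  ultimately have "D \<ge> 1" by linarith
  then have "log 2 D \<ge> 0" by simp
  have "2 * (a + 1) * 3 \<le> C"
    unfolding C_def using assms \<open>log 2 D \<ge> 0\<close> by (intro mult_left_mono) auto
  then have C: "C > 0" "a + 1 \<le> C" using assms by (simp_all add: algebra_simps)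
  have "\<exists>G. dnf_on n G \<and> real (dnf_width G) \<le> C * lg (real n) \<and>
      real (card G) \<le> real n powr (C * lg (lg (real n))) \<and>
      measure_pmf.prob (pmf_of_set (cube n)) {x. f x \<noteq> eval_dnf G x} \<le> real n powr (- c)"
    if n: "n \<ge> 2" and F: "computes n F f" "real (dnf_width F) \<le> a * lg (real n)"
    for n :: nat and f F
  proof -
    define l where "l = log 2 (real n)"
    define L where "L = lg (real n)"
    have "l \<ge> 1" using n by (simp add: l_def)
    have L: "L \<ge> 2" "l \<le> L" "L \<le> 2 * l"
      using \<open>l \<ge> 1\<close> by (auto simp: L_def lg_def l_def)
    have n_powr: "2 powr (l * z) = n powr z" for z
      using n by (simp add: l_def powr_powr[symmetric])
    \<comment> \<open>The sparsification asks for \<open>w \<ge> 1\<close>, while a formula may have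
      width 0.\<close>
    define w where "w = max 1 (dnf_width F)"
    have "w \<ge> 1" by (simp add: w_def)
    have "1 * 1 \<le> (a + 1) * L" using L assms by (intro mult_mono) auto
    then have wL: "real w \<le> (a + 1) * L"
      using F(2) L by (auto simp: w_def L_def[symmetric] max_def algebra_simps)
    \<comment> \<open>Makes \<open>2 ^ m\<close> at least \<open>n powr (2 * w + 2 + c)\<close>: the
      part \<open>n powr (2 * w + 2)\<close> pays for the number of terms, and
      \<open>n powr c\<close> remains for the error.\<close>
    define m where "m = nat \<lceil>(2 * w + 2 + c) * l\<rceil>"
    have m_ge: "m \<ge> (2 * w + 2 + c) * l" unfolding m_def by (rule real_nat_ceiling_ge)
    have pos: "1 * 1 \<le> (2 * w + 2 + c) * l" using assms \<open>l \<ge> 1\<close> by (intro mult_mono) auto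
    then have "m \<ge> 1" using m_ge by linarith
    have mL: "m \<le> (2 * a + c + 5) * L ^ 2"
    proof -
      have "m \<le> (2 * w + 2 + c) * l + 1"
        unfolding m_def using pos of_int_ceiling_le_add_one[of "(2 * w + 2 + c) * l"] by linarith
      also have "\<dots> \<le> (2 * ((a + 1) * L) + (2 + c) * L) * L + L * L"
      proof -
        have "2 + c \<le> (2 + c) * L" using L assms by simp
        then have "2 * w + 2 + c \<le> 2 * ((a + 1) * L) + (2 + c) * L" using wL by simp
        then have "(2 * w + 2 + c) * l \<le> (2 * ((a + 1) * L) + (2 + c) * L) * L"
          by (rule mult_mono) (use assms L \<open>l \<ge> 1\<close> in auto)
        moreover have "1 \<le> L * L" using L mult_mono[of 1 L 1 L] by simp
        ultimately show ?thesis by linarith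
      qed
      also have "\<dots> = (2 * a + c + 5) * L ^ 2" by (simp add: algebra_simps power2_eq_square)
      finally show ?thesis .
    qed
    have onF: "dnf_on n F" and compF: "\<forall>x\<in>cube n. eval_dnf F x = f x"
      using F(1) by (auto simp: computes_def)
    then have "F \<subseteq> Pow {l. var l < n}" by (auto simp: dnf_on_def)
    then have finF: "finite F" using finite_literals by (meson finite_Pow_iff finite_subset)
    \<comment> \<open>Contradictory terms are dropped, which keeps the function and leaves the
      satisfiable terms that the sparsification asks for.\<close>
    define F0 where "F0 = {t \<in> F. \<exists>y. eval_term t y}"
    have evalF0: "eval_dnf F0 x = eval_dnf F x" for x by (auto simp: F0_def eval_dnf_def)
    have onF0: "dnf_on n F0" using onF by (auto simp: F0_def dnf_on_def)
    have wF0: "\<forall>t\<in>F0. card t \<le> w"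
    proof
      fix t assume "t \<in> F0"
      then have "card t \<le> dnf_width F"
        unfolding dnf_width_def using finF by (intro Max_ge) (auto simp: F0_def)
      then show "card t \<le> w" by (simp add: w_def)
    qed
    define K where "K = real (6 * w * m)"
    have "\<forall>t\<in>F0. \<exists>y. eval_term t y" by (simp add: F0_def)
    from dnf_sparsification[OF onF0 this wF0 \<open>w \<ge> 1\<close> \<open>m \<ge> 1\<close> K_def]
    obtain G where G: "dnf_on n G" "\<forall>t\<in>G. card t \<le> w" "real (card G) \<le> (2 * K) ^ w"
      and err: "real (card {x \<in> cube n. eval_dnf F0 x \<noteq> eval_dnf G x}) \<le> card F0 * (2 ^ n / 2 ^ m)"
      by blast
    have "G \<subseteq> Pow {l. var l < n}" using G(1) by (auto simp: dnf_on_def)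
    then have "finite G" using finite_literals by (meson finite_Pow_iff finite_subset)
    then have "dnf_width G \<le> w" unfolding dnf_width_def using G(2) by (intro Max.boundedI) auto
    then have "real (dnf_width G) \<le> (a + 1) * L" using wL by linarith
    also have "\<dots> \<le> C * L" using C L by (intro mult_right_mono) auto
    finally have width: "real (dnf_width G) \<le> C * lg (real n)" by (simp add: L_def)
    have size: "real (card G) \<le> real n powr (C * lg (lg (real n)))"
    proof -
      define LL where "LL = lg L"
      have LL: "LL \<ge> 2" "log 2 L \<le> LL" by (auto simp: LL_def lg_def)
      have "2 * K = 12 * (real w * real m)" by (simp add: K_def)
      also have "\<dots> \<le> 12 * (((a + 1) * L) * ((2 * a + c + 5) * L ^ 2))"
        using wL mL assms L by (intro mult_left_mono mult_mono) auto
      also have "\<dots> = D * L ^ 3" by (simp add: D_def power2_eq_square power3_eq_cube)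
      also have "\<dots> = 2 powr (log 2 D + 3 * log 2 L)"
      proof -
        have "2 powr (3 * log 2 L) = L ^ 3"
          using L by (simp add: mult.commute[of 3] powr_powr[symmetric] powr_numeral)
        then show ?thesis using \<open>D \<ge> 1\<close> by (simp add: powr_add)
      qed
      also have "\<dots> \<le> 2 powr ((log 2 D + 3) * LL)"
      proof -
        have "log 2 D * 1 \<le> log 2 D * LL" using LL \<open>log 2 D \<ge> 0\<close> by (intro mult_left_mono) auto
        then show ?thesis using LL by (simp add: algebra_simps)
      qed
      finally have "(2 * K) ^ w \<le> (2 powr ((log 2 D + 3) * LL)) ^ w"
        by (intro power_mono) (auto simp: K_def)
      also have "\<dots> = 2 powr (w * ((log 2 D + 3) * LL))"
        by (simp add: powr_realpow[symmetric] powr_powr mult.commute)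
      also have "\<dots> \<le> 2 powr (((a + 1) * (2 * l)) * ((log 2 D + 3) * LL))"
      proof -
        have "(a + 1) * L \<le> (a + 1) * (2 * l)" using L assms by (intro mult_left_mono) auto
        then have "real w \<le> (a + 1) * (2 * l)" using wL by linarith
        then show ?thesis
          using LL \<open>log 2 D \<ge> 0\<close> by (intro powr_mono mult_right_mono) auto
      qed
      also have "((a + 1) * (2 * l)) * ((log 2 D + 3) * LL) = l * (C * LL)"
        by (simp add: C_def algebra_simps)
      finally show ?thesis using G(3) by (simp add: n_powr LL_def L_def)
    qed
    have cube_ne: "cube n \<noteq> {}" using card_cube[of n] by auto
    \<comment> \<open>\<open>f\<close> and \<open>F\<close> are known to agree only on the cube, the
      support of the distribution.\<close>
    have "cube n \<inter> {x. f x \<noteq> eval_dnf G x} = {x \<in> cube n. eval_dnf F0 x \<noteq> eval_dnf G x}"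
      using compF evalF0 by auto
    then have "measure_pmf.prob (pmf_of_set (cube n)) {x. f x \<noteq> eval_dnf G x} =
        card {x \<in> cube n. eval_dnf F0 x \<noteq> eval_dnf G x} / 2 ^ n"
      using cube_ne by (simp add: measure_pmf_of_set finite_cube card_cube)
    also have "\<dots> \<le> card F0 * (2 ^ n / 2 ^ m) / 2 ^ n" using err by (intro divide_right_mono) auto
    also have "\<dots> = card F0 / 2 ^ m" by simp
    also have "\<dots> \<le> n powr (2 * w + 2) / n powr (2 * w + 2 + c)"
    proof (rule frac_le)
      have "card F0 \<le> (2 * n) ^ Suc w" using card_dnf_le[OF onF0] wF0 n by auto
      also have "\<dots> \<le> (n * n) ^ Suc w" using n by (intro power_mono) auto
      also have "\<dots> = n ^ (2 * w + 2)"
        by (simp add: power_mult_distrib power2_eq_square mult_2 flip: power_add)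
      finally have "real (card F0) \<le> real (n ^ (2 * w + 2))" by (simp only: of_nat_le_iff)
      also have "\<dots> = n powr real (2 * w + 2)" using n by (subst powr_realpow) auto
      finally show "card F0 \<le> n powr (2 * w + 2)" by simp
      have "n powr (2 * w + 2 + c) = 2 powr ((2 * w + 2 + c) * l)"
        by (simp add: mult.commute flip: n_powr)
      also have "\<dots> \<le> 2 powr m" using m_ge by simp
      also have "\<dots> = 2 ^ m" by (simp add: powr_realpow)
      finally show "n powr (2 * w + 2 + c) \<le> 2 ^ m" .
    qed (use n in auto)
    also have "\<dots> = n powr (- c)" by (simp flip: powr_diff)
    finally show ?thesis using G(1) width size by blast
  qed
  then show ?thesis using C(1) by blast
qed

end
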